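(* Let $G$ be a graph on $n$ vertices. Then Dominator can win the Maker–Breaker domination game on $G\square K_2$ in at most $n$ moves. If Dominator has a winning strategy in the game on $G$ both as the first and as the second player, then $\gamma_{MB}(G\square K_2)\leq \min\{\gamma_{MB}(G)+\gamma'_{MB}(G),\ n\}$ and $\gamma'_{MB}(G\square K_2)\leq\min\{2\gamma'_{MB}(G),\ n\}$.
   Context: $G\square K_2$ denotes the Cartesian product of $G$ with the complete graph on two vertices. In the Maker–Breaker domination game on a graph $G$, two players, Dominator and Staller, alternately claim previously unclaimed vertices of $G$. Dominator wins if the set of vertices he claims becomes a dominating set of $G$ (every vertex not in it has a neighbour in it); Staller wins if she claims some vertex together with all of its neighbours. In the $D$-game Dominator moves first, in the $S$-game Staller moves first. $\gamma_{MB}(G)$ is the minimum number of moves Dominator needs to win the $D$-game on $G$ against optimal play by Staller (who tries to postpone his win), and $\gamma'_{MB}(G)$ the analogous quantity for the $S$-game. *)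

theory Defs
  imports "Graph_Theory.Graph_Theory" "HOL-Library.Extended_Nat"
begin

text \<open>
  Finite simple graphs are modelled by the locale \<^locale>\<open>pair_graph\<close>: finite vertex set, and an
  irreflexive, symmetric set of arcs, so that an edge is a pair of opposite arcs.
\<close>

definition cartesian_product ::
  "'a pair_pre_digraph \<Rightarrow> 'b pair_pre_digraph \<Rightarrow> ('a \<times> 'b) pair_pre_digraph" (infixl "\<box>" 70) where
  "G \<box> H = \<lparr> pverts = pverts G \<times> pverts H,
             parcs = {((u, x), (v, y)) | u x v y.
               u = v \<and> u \<in> pverts G \<and> (x, y) \<in> parcs H \<or>
               (u, v) \<in> parcs G \<and> x = y \<and> x \<in> pverts H} \<rparr>"

definition K2 :: "bool pair_pre_digraph" where
  "K2 = \<lparr> pverts = UNIV, parcs = {(x, y). x \<noteq> y} \<rparr>"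

lemma complete_digraph_K2: "complete_digraph 2 (with_proj K2)"
  by (auto simp: complete_digraph_pair_def K2_def)

lemma pair_graph_cartesian_product:
  assumes "pair_graph G" "pair_graph H"
  shows "pair_graph (G \<box> H)"
proof -
  interpret G: pair_graph G by fact
  interpret H: pair_graph H by fact
  have wf: "parcs (G \<box> H) \<subseteq> pverts (G \<box> H) \<times> pverts (G \<box> H)"
    by (auto simp: cartesian_product_def dest: G.wellformed' H.wellformed')
  have fin: "finite (pverts (G \<box> H))"
    by (simp add: cartesian_product_def)
  have "sym (parcs (G \<box> H))"
    using G.pair_sym_arcs H.pair_sym_arcs
    by (auto simp: symmetric_def cartesian_product_def sym_def)
  moreover have "fst e \<noteq> snd e" if "e \<in> parcs (G \<box> H)" for e
    using that by (auto simp: cartesian_product_def dest: G.pair_no_loops H.pair_no_loops)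
  moreover have "finite (parcs (G \<box> H))"
    using finite_subset[OF wf] fin by simp
  ultimately show ?thesis
    using wf fin by unfold_locales (auto simp: symmetric_def)
qed

definition dominating_set :: "'a pair_pre_digraph \<Rightarrow> 'a set \<Rightarrow> bool" where
  "dominating_set G D \<longleftrightarrow>
     D \<subseteq> pverts G \<and> (\<forall>v \<in> pverts G - D. \<exists>u \<in> D. (u, v) \<in> parcs G)"

datatype player = Dominator | Staller

fun opponent :: "player \<Rightarrow> player" where
  "opponent Dominator = Staller"
| "opponent Staller = Dominator"

text \<open>
  A play is recorded as the list of the vertices claimed so far, in chronological order. The
  parameter \<open>first\<close> is the player who makes the first move: \<^const>\<open>Dominator\<close> in the D-game,
  \<^const>\<open>Staller\<close> in the S-game.
\<close>

definition to_move :: "player \<Rightarrow> nat \<Rightarrow> player" where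
  "to_move first i = (if even i then first else opponent first)"

definition partial_play :: "'a pair_pre_digraph \<Rightarrow> 'a list \<Rightarrow> bool" where
  "partial_play G p \<longleftrightarrow> distinct p \<and> set p \<subseteq> pverts G"

definition complete_play :: "'a pair_pre_digraph \<Rightarrow> 'a list \<Rightarrow> bool" where
  "complete_play G p \<longleftrightarrow> distinct p \<and> set p = pverts G"

definition claimed :: "player \<Rightarrow> player \<Rightarrow> 'a list \<Rightarrow> 'a set" where
  "claimed first P p = {p ! i | i. i < length p \<and> to_move first i = P}"

text \<open>
  A strategy of Dominator maps the history of the game to his next move.
\<close>

definition follows :: "player \<Rightarrow> ('a list \<Rightarrow> 'a) \<Rightarrow> 'a list \<Rightarrow> bool" where
  "follows first \<sigma> p \<longleftrightarrow>
     (\<forall>i < length p. to_move first i = Dominator \<longrightarrow> p ! i = \<sigma> (take i p))"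

definition dominator_strategy ::
  "'a pair_pre_digraph \<Rightarrow> player \<Rightarrow> ('a list \<Rightarrow> 'a) \<Rightarrow> bool" where
  "dominator_strategy G first \<sigma> \<longleftrightarrow>
     (\<forall>p. partial_play G p \<and> follows first \<sigma> p \<and> set p \<noteq> pverts G
            \<and> to_move first (length p) = Dominator
          \<longrightarrow> \<sigma> p \<in> pverts G - set p)"

text \<open>
  The number of moves Dominator has made when his vertices first form a dominating set; it is
  \<open>\<infinity>\<close> if they never do. Plays are continued until all vertices are claimed, which does not
  affect the outcome: Staller owns a vertex together with all its neighbours at some point of a
  complete play iff Dominator's vertices never form a dominating set in it.
\<close>

definition moves_to_win :: "'a pair_pre_digraph \<Rightarrow> player \<Rightarrow> 'a list \<Rightarrow> enat" where
  "moves_to_win G first p =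
     (INF i \<in> {i. i \<le> length p \<and> dominating_set G (claimed first Dominator (take i p))}.
        enat (card (claimed first Dominator (take i p))))"

definition dominator_wins :: "'a pair_pre_digraph \<Rightarrow> player \<Rightarrow> bool" where
  "dominator_wins G first \<longleftrightarrow>
     (\<exists>\<sigma>. dominator_strategy G first \<sigma> \<and>
        (\<forall>p. complete_play G p \<and> follows first \<sigma> p \<longrightarrow> moves_to_win G first p < \<infinity>))"

definition dominator_wins_within :: "'a pair_pre_digraph \<Rightarrow> player \<Rightarrow> nat \<Rightarrow> bool" where
  "dominator_wins_within G first k \<longleftrightarrow>
     (\<exists>\<sigma>. dominator_strategy G first \<sigma> \<and>
        (\<forall>p. complete_play G p \<and> follows first \<sigma> p \<longrightarrow> moves_to_win G first p \<le> enat k))"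

text \<open>
  Dominator minimises and Staller maximises the number of Dominator's moves; the value is \<open>\<infinity>\<close> if
  Dominator has no winning strategy.
\<close>

definition mb_number :: "'a pair_pre_digraph \<Rightarrow> player \<Rightarrow> enat" where
  "mb_number G first =
     (INF \<sigma> \<in> {\<sigma>. dominator_strategy G first \<sigma>}.
        SUP p \<in> {p. complete_play G p \<and> follows first \<sigma> p}. moves_to_win G first p)"

definition gamma_MB :: "'a pair_pre_digraph \<Rightarrow> enat" where
  "gamma_MB G = mb_number G Dominator"

definition gamma_MB' :: "'a pair_pre_digraph \<Rightarrow> enat" where
  "gamma_MB' G = mb_number G Staller"

end

theory Submission
  imports Defs
begin

text \<open>
  Dominator plays on the two copies of \<open>G\<close> separately, replying in the copy in which Staller has
  just moved, until one copy is dominated; from then on all his moves go to the other copy, where a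
  surplus move cannot hurt him. Hence no move is wasted and the numbers of moves in the two copies
  add up. The bound \<open>n\<close> comes from pairing \<open>(v, False)\<close> with \<open>(v, True)\<close>: Dominator needs
  only one vertex of each pair, and he can gain a new pair with every move.
\<close>

section \<open>Winning positions with a budget of moves\<close>

text \<open>
  In \<open>dwin G P A F k\<close> it is the turn of \<open>P\<close>, Dominator owns \<open>A\<close>, the vertices in
  \<open>F\<close> are unclaimed, and Dominator can win with at most \<open>k\<close> further moves.
\<close>

inductive dwin :: "'a pair_pre_digraph \<Rightarrow> player \<Rightarrow> 'a set \<Rightarrow> 'a set \<Rightarrow> nat \<Rightarrow> bool" for G where
  dominated: "dominating_set G A \<Longrightarrow> dwin G P A F k"
| dominator_moves:
    "v \<in> F \<Longrightarrow> dwin G Staller (insert v A) (F - {v}) k \<Longrightarrow> dwin G Dominator A F (Suc k)"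
| staller_moves:
    "F \<noteq> {} \<Longrightarrow> (\<And>v. v \<in> F \<Longrightarrow> dwin G Dominator A (F - {v}) k) \<Longrightarrow> dwin G Staller A F k"

lemma dwin_mono:
  assumes "dwin G P A F k" "k \<le> l"
  shows "dwin G P A F l"
  using assms
proof (induction arbitrary: l)
  case (dominator_moves v F A k)
  from dominator_moves.prems obtain l' where "l = Suc l'" "k \<le> l'"
    by (cases l) auto
  then show ?case
    using dominator_moves dwin.dominator_moves by metis
qed (auto intro: dwin.intros)

text \<open>
  The two parts depend on each other: if Staller takes the new vertex \<open>x\<close>, Dominator is to move
  in the old position, in which it was Staller's turn.
\<close>

lemma dwin_skip_and_insert:
  assumes "dwin G P A F k"
  shows "dwin G Dominator A F k \<and> dwin G P A (insert x F) k"
  using assms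
proof (induction arbitrary: x)
  case (dominated A P F k)
  then show ?case by (auto intro: dwin.dominated)
next
  case (dominator_moves v F A k)
  have "dwin G Dominator A F (Suc k)"
    using dominator_moves.hyps by (rule dwin.dominator_moves)
  moreover have "dwin G Dominator A (insert x F) (Suc k)" if "x \<notin> F"
  proof (rule dwin.dominator_moves)
    show "v \<in> insert x F" using dominator_moves.hyps by simp
    have "insert x F - {v} = insert x (F - {v})"
      using that dominator_moves.hyps by auto
    then show "dwin G Staller (insert v A) (insert x F - {v}) k"
      using dominator_moves.IH by simp
  qed
  ultimately show ?case by (cases "x \<in> F") (auto simp: insert_absorb)
next
  case (staller_moves F A k)
  from \<open>F \<noteq> {}\<close> obtain y where "y \<in> F" by auto
  \<comment> \<open>Putting \<open>y\<close> back into \<open>F - {y}\<close> restores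
    \<open>F\<close>, so the insertion half of the induction hypothesis, with \<open>y\<close> as
    both taken and inserted vertex, yields the skipping half.\<close>
  then have skip: "dwin G Dominator A F k"
    using staller_moves.IH[of y y] by (simp add: insert_absorb)
  have "dwin G Staller A (insert x F) k"
  proof (cases "x \<in> F")
    case True
    then show ?thesis
      using dwin.staller_moves[OF staller_moves.hyps] by (simp add: insert_absorb)
  next
    case False
    show ?thesis
    proof (rule dwin.staller_moves)
      fix v assume v: "v \<in> insert x F"
      show "dwin G Dominator A (insert x F - {v}) k"
      proof (cases "v = x")
        case True
        then show ?thesis using skip False by simp
      next
        case neq: False
        then have "insert x F - {v} = insert x (F - {v})" by auto
        then show ?thesis using staller_moves.IH[of v x] v neq by simp
      qed
    qed simp
  qed
  with skip show ?case ..
qed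

lemma dwin_skip: "dwin G P A F k \<Longrightarrow> dwin G Dominator A F k"
  by (rule dwin_skip_and_insert[THEN conjunct1])

section \<open>Positions on the two copies\<close>

definition slice :: "'b \<Rightarrow> ('a \<times> 'b) set \<Rightarrow> 'a set" where
  "slice b X = {v. (v, b) \<in> X}"

lemma slice_insert: "slice b (insert (v, c) X) = (if b = c then insert v (slice b X) else slice b X)"
  by (auto simp: slice_def)

lemma slice_Diff: "slice b (X - {(v, c)}) = (if b = c then slice b X - {v} else slice b X)"
  by (auto simp: slice_def)

lemma mem_slice: "v \<in> slice b X \<longleftrightarrow> (v, b) \<in> X"
  by (simp add: slice_def)

lemma pverts_prod_K2: "pverts (G \<box> K2) = pverts G \<times> UNIV"
  by (simp add: cartesian_product_def K2_def)

lemma parcs_prod_K2: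
  "((u, x), (v, y)) \<in> parcs (G \<box> K2) \<longleftrightarrow>
     u = v \<and> u \<in> pverts G \<and> x \<noteq> y \<or> (u, v) \<in> parcs G \<and> x = y"
  by (simp add: cartesian_product_def K2_def)

lemma dominating_set_prod_K2:
  assumes "\<And>b. dominating_set G (slice b A)"
  shows "dominating_set (G \<box> K2) A"
  unfolding dominating_set_def
proof (intro conjI ballI)
  show "A \<subseteq> pverts (G \<box> K2)"
    using assms by (auto simp: dominating_set_def pverts_prod_K2 slice_def)
  fix x assume "x \<in> pverts (G \<box> K2) - A"
  then obtain v b where x: "x = (v, b)" and "v \<in> pverts G - slice b A"
    by (auto simp: pverts_prod_K2 mem_slice)
  then obtain u where "(u, b) \<in> A" "(u, v) \<in> parcs G"
    using assms[of b] unfolding dominating_set_def by (metis mem_slice)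
  then show "\<exists>y\<in>A. (y, x) \<in> parcs (G \<box> K2)"
    unfolding x by (intro bexI[of _ "(u, b)"]) (simp_all add: parcs_prod_K2)
qed

text \<open>The budgets add because each move of Dominator is charged to one copy only. The
  invariant keeps Staller to move in the copy other than \<open>b\<close>; after a move of Staller,
  the copy she played in takes the role of \<open>b\<close>.\<close>

lemma dwin_prod_K2:
  assumes "finite F"
    and "dwin G P (slice b A) (slice b F) k"
    and "dwin G Staller (slice (\<not> b) A) (slice (\<not> b) F) l"
  shows "dwin (G \<box> K2) P A F (k + l)"
  using assms
proof (induction "card F" arbitrary: P b A F k l rule: less_induct)
  case less
  have smaller: "card (F - {x}) < card F" if "x \<in> F" for x
    using less.prems(1) that by (rule card_Diff1_less)
  show ?case
  proof (cases "\<forall>c. dominating_set G (slice c A)")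
    case True
    then show ?thesis by (auto intro: dwin.dominated dominating_set_prod_K2)
  next
    case undominated: False
    show ?thesis
    proof (cases P)
      case Staller
      \<comment> \<open>With Staller to move in both copies the situation is symmetric, so the copy
        \<open>c\<close> she plays in and the budgets \<open>i\<close>, \<open>j\<close> are left
        general.\<close>
      have step: "dwin (G \<box> K2) Dominator A (F - {(v, c)}) (i + j)"
        if vF: "(v, c) \<in> F" and here: "dwin G Staller (slice c A) (slice c F) i"
          and there: "dwin G Staller (slice (\<not> c) A) (slice (\<not> c) F) j" for v c i j
      proof (rule less.hyps)
        from here show "dwin G Dominator (slice c A) (slice c (F - {(v, c)})) i"
          using vF by cases (auto simp: slice_Diff mem_slice intro: dwin.dominated)
      qed (use vF there less.prems(1) smaller in \<open>auto simp: slice_Diff\<close>)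
      \<comment> \<open>On an exhausted board only \<open>dominated\<close> can justify a position
        with Staller to move, so both copies would be dominated.\<close>
      have "F \<noteq> {}"
      proof
        assume "F = {}"
        have "dominating_set G (slice c A)" for c
        proof (cases "c = b")
          case True
          from less.prems(2)[unfolded Staller] show ?thesis
            using \<open>F = {}\<close> True by cases (auto simp: slice_def)
        next
          case False
          then have "(\<not> b) = c" by auto
          from less.prems(3) show ?thesis
            using \<open>F = {}\<close> \<open>(\<not> b) = c\<close> by cases (auto simp: slice_def)
        qed
        with undominated show False by blast
      qed
      moreover have "dwin (G \<box> K2) Dominator A (F - {(v, c)}) (k + l)" if "(v, c) \<in> F" for v c
      proof (cases "c = b")
        case True
        then show ?thesis using step[of v b k l] that less.prems Staller by simp
      next
        case False
        then have "c = (\<not> b)" by auto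
        then show ?thesis
          using step[of v "\<not> b" l k] that less.prems Staller by (simp add: add.commute)
      qed
      ultimately show ?thesis
        unfolding Staller by (intro dwin.staller_moves) auto
    next
      case Dominator
      \<comment> \<open>In an undominated copy the rule behind \<open>here\<close> must be
        \<open>dominator_moves\<close>, so the move spent there really lowers the budget of that
        copy.\<close>
      have step: "dwin (G \<box> K2) Dominator A F (i + j)"
        if here: "dwin G Dominator (slice c A) (slice c F) i"
          and undom: "\<not> dominating_set G (slice c A)"
          and there: "dwin G Staller (slice (\<not> c) A) (slice (\<not> c) F) j" for c i j
        using here
      proof cases
        case (dominator_moves v i')
        have "dwin (G \<box> K2) Staller (insert (v, c) A) (F - {(v, c)}) (i' + j)"
          using dominator_moves less.prems(1) smaller there
          by (intro less.hyps[of _ _ c]) (auto simp: slice_Diff slice_insert mem_slice)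
        then show ?thesis
          using dominator_moves dwin.dominator_moves[of "(v, c)"] by (simp add: mem_slice)
      qed (use undom in auto)
      show ?thesis
      proof (cases "dominating_set G (slice b A)")
        case False
        then show ?thesis using step[of b k l] less.prems Dominator by simp
      next
        case True
        \<comment> \<open>Copy \<open>b\<close> is finished, so the move goes to the other copy
          although Staller is to move there: getting the turn early cannot hurt Dominator.\<close>
        have "dwin (G \<box> K2) Dominator A F (l + k)"
        proof (rule step[of "\<not> b"])
          show "\<not> dominating_set G (slice (\<not> b) A)"
            using undominated True by (cases b) (auto simp: all_bool_eq)
          show "dwin G Dominator (slice (\<not> b) A) (slice (\<not> b) F) l"
            using less.prems(3) by (rule dwin_skip)
          show "dwin G Staller (slice (\<not> \<not> b) A) (slice (\<not> \<not> b) F) k"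
            using True by (auto intro: dwin.dominated)
        qed
        then show ?thesis using Dominator by (simp add: add.commute)
      qed
    qed
  qed
qed

section \<open>The pairing strategy\<close>

text \<open>\<open>m\<close> counts the pairs without a vertex of Dominator; when Staller is to
  move, both vertices of such a pair are free. Her move touches at most one of these pairs;
  Dominator answers there, or in any of them if she touched none, and \<open>m\<close> drops by
  one.\<close>

lemma dwin_pairing:
  assumes "A \<subseteq> pverts G \<times> UNIV" "(pverts G - fst ` A) \<times> UNIV \<subseteq> F"
    and "finite (pverts G)" "card (pverts G - fst ` A) = m"
  shows "dwin (G \<box> K2) Staller A F m"
  using assms
proof (induction m arbitrary: A F)
  case 0
  then have "pverts G \<subseteq> fst ` A" by simp
  have "dominating_set (G \<box> K2) A"
    unfolding dominating_set_def
  proof (intro conjI ballI)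
    show "A \<subseteq> pverts (G \<box> K2)" using 0(1) by (simp add: pverts_prod_K2)
    fix x assume x: "x \<in> pverts (G \<box> K2) - A"
    then have "fst x \<in> fst ` A" using \<open>pverts G \<subseteq> fst ` A\<close> by (auto simp: pverts_prod_K2)
    then obtain c where "(fst x, c) \<in> A" by force
    \<comment> \<open>As \<open>x\<close> is not in \<open>A\<close>, the vertex
      \<open>(fst x, c)\<close> is its twin in the other copy, adjacent to it by a \<open>K2\<close>
      edge.\<close>
    with x show "\<exists>y\<in>A. (y, x) \<in> parcs (G \<box> K2)"
      by (cases x; cases c) (auto simp: pverts_prod_K2 parcs_prod_K2 intro!: bexI[of _ "(fst x, c)"])
  qed
  then show ?case by (rule dwin.dominated)
next
  case (Suc m)
  then obtain u where u: "u \<in> pverts G - fst ` A"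
    by (metis card.empty ex_in_conv nat.distinct(1))
  show ?case
  proof (rule dwin.staller_moves)
    show "F \<noteq> {}" using u Suc.prems(2) by auto
    fix x assume "x \<in> F"
    obtain w b where x: "x = (w, b)" by (cases x)
    \<comment> \<open>If Staller opened the pair of \<open>w\<close>, then
      \<open>(w, \<not> b)\<close> is the twin of her vertex; otherwise \<open>u\<close> differs
      from \<open>w\<close> and either vertex over \<open>u\<close> would do.\<close>
    define v where "v = (if w \<in> pverts G - fst ` A then w else u)"
    have v: "v \<in> pverts G - fst ` A" using u by (simp add: v_def)
    have eq: "pverts G - fst ` insert (v, \<not> b) A = pverts G - fst ` A - {v}" by auto
    have "(v, \<not> b) \<in> F - {x}"
      using v Suc.prems(2) x by auto
    moreover have "dwin (G \<box> K2) Staller (insert (v, \<not> b) A) (F - {x} - {(v, \<not> b)}) m"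
    proof (rule Suc.IH)
      show "(pverts G - fst ` insert (v, \<not> b) A) \<times> UNIV \<subseteq> F - {x} - {(v, \<not> b)}"
        unfolding eq using Suc.prems(2) by (auto simp: x v_def split: if_splits)
      show "card (pverts G - fst ` insert (v, \<not> b) A) = m"
        unfolding eq using v Suc.prems(3,4) by simp
      show "insert (v, \<not> b) A \<subseteq> pverts G \<times> UNIV" using v Suc.prems(1) by simp
    qed (rule Suc.prems(3))
    ultimately show "dwin (G \<box> K2) Dominator A (F - {x}) (Suc m)"
      by (rule dwin.dominator_moves)
  qed
qed

section \<open>Recorded plays and the vertices claimed in them\<close>

lemma claimed_Nil [simp]: "claimed first P [] = {}"
  by (simp add: claimed_def)

lemma claimed_snoc:
  "claimed first P (p @ [v]) =
     (if to_move first (length p) = P then insert v (claimed first P p) else claimed first P p)"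
proof -
  have *: "claimed first P q = (!) q ` {i \<in> {..<length q}. to_move first i = P}" for q
    by (auto simp: claimed_def)
  moreover have "{i \<in> {..<length (p @ [v])}. to_move first i = P} =
      (if to_move first (length p) = P then insert (length p) else id)
        {i \<in> {..<length p}. to_move first i = P}"
    by (auto simp: less_Suc_eq)
  moreover have "(!) (p @ [v]) ` {i \<in> {..<length p}. to_move first i = P} =
      (!) p ` {i \<in> {..<length p}. to_move first i = P}"
    by (intro image_cong) (auto simp: nth_append)
  ultimately show ?thesis unfolding * by simp
qed

lemma claimed_subset: "claimed first P p \<subseteq> set p"
  by (auto simp: claimed_def)

lemma to_move_Suc: "to_move first (Suc i) = opponent (to_move first i)"
  by (cases first) (auto simp: to_move_def)

lemma finite_claimed: "finite (claimed first P p)"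
  using claimed_subset finite_set by (rule finite_subset)

lemma card_claimed_snoc:
  assumes "v \<notin> set p"
  shows "card (claimed first P (p @ [v])) =
     (if to_move first (length p) = P then Suc (card (claimed first P p))
      else card (claimed first P p))"
proof -
  have "v \<notin> claimed first P p" using assms claimed_subset by fastforce
  then show ?thesis by (simp add: claimed_snoc finite_claimed)
qed

lemma follows_snoc:
  "follows first \<sigma> (p @ [v]) \<longleftrightarrow>
     follows first \<sigma> p \<and> (to_move first (length p) = Dominator \<longrightarrow> v = \<sigma> p)"
  by (auto simp: follows_def less_Suc_eq nth_append)

text \<open>A bound on \<open>moves_to_win\<close> freed of the infimum, suited to induction over
  plays.\<close>

definition won_within :: "'a pair_pre_digraph \<Rightarrow> player \<Rightarrow> nat \<Rightarrow> 'a list \<Rightarrow> bool" where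
  "won_within G first k p \<longleftrightarrow>
     (\<exists>i\<le>length p. dominating_set G (claimed first Dominator (take i p)) \<and>
        card (claimed first Dominator (take i p)) \<le> k)"

lemma moves_to_win_le_iff: "moves_to_win G first p \<le> enat k \<longleftrightarrow> won_within G first k p"
proof -
  \<comment> \<open>A strict bound on an infimum yields a witness directly, so the weak bound
    \<open>k\<close> is turned into the strict bound \<open>Suc k\<close>.\<close>
  have "moves_to_win G first p \<le> enat k \<longleftrightarrow> moves_to_win G first p < enat (Suc k)"
    by (cases "moves_to_win G first p") auto
  also have "\<dots> \<longleftrightarrow> won_within G first k p"
    by (auto simp: moves_to_win_def won_within_def INF_less_iff less_Suc_eq_le)
  finally show ?thesis .
qed

lemma won_within_snoc:
  "won_within G first k (p @ [v]) \<longleftrightarrow> won_within G first k p \<or>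
     dominating_set G (claimed first Dominator (p @ [v])) \<and>
     card (claimed first Dominator (p @ [v])) \<le> k"
proof -
  have "(\<exists>i\<le>length (p @ [v]). Q (take i (p @ [v]))) \<longleftrightarrow>
        (\<exists>i\<le>length p. Q (take i p)) \<or> Q (p @ [v])" for Q
    by (auto simp: le_Suc_eq)
  from this[of "\<lambda>q. dominating_set G (claimed first Dominator q) \<and>
      card (claimed first Dominator q) \<le> k"]
  show ?thesis unfolding won_within_def .
qed

lemma won_within_now:
  assumes "dominating_set G (claimed first Dominator p)" "card (claimed first Dominator p) \<le> k"
  shows "won_within G first k p"
  using assms unfolding won_within_def by (intro exI[of _ "length p"]) simp

section \<open>Strategies and winning positions\<close>

text \<open>Backward induction along the plays that follow \<open>\<sigma>\<close>, from complete
  plays to shorter ones. The first alternative covers plays that were won earlier and in which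
  Dominator may since have made more than \<open>k\<close> moves, leaving no budget
  \<open>l\<close>.\<close>

lemma strategy_imp_dwin:
  assumes fin: "finite (pverts G)" and strat: "dominator_strategy G first \<sigma>"
    and win: "\<And>p. complete_play G p \<Longrightarrow> follows first \<sigma> p \<Longrightarrow> won_within G first k p"
    and "partial_play G p" "follows first \<sigma> p"
  shows "won_within G first k p \<or>
    (\<exists>l. l + card (claimed first Dominator p) = k \<and>
      dwin G (to_move first (length p)) (claimed first Dominator p) (pverts G - set p) l)"
  using assms(4,5)
proof (induction "card (pverts G - set p)" arbitrary: p rule: less_induct)
  case less
  have IH: "won_within G first k (p @ [v]) \<or>
    (\<exists>l. l + card (claimed first Dominator (p @ [v])) = k \<and>
      dwin G (opponent (to_move first (length p))) (claimed first Dominator (p @ [v]))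
        (pverts G - set p - {v}) l)"
    if "v \<in> pverts G - set p" "to_move first (length p) = Dominator \<longrightarrow> v = \<sigma> p" for v
  proof -
    have eq: "pverts G - set (p @ [v]) = pverts G - set p - {v}" by auto
    have "card (pverts G - set (p @ [v])) < card (pverts G - set p)"
      unfolding eq using fin that by (intro card_Diff1_less) auto
    moreover have "partial_play G (p @ [v])"
      using less.prems that by (auto simp: partial_play_def)
    ultimately show ?thesis
      using less.hyps[of "p @ [v]"] less.prems that
      unfolding eq by (simp add: follows_snoc to_move_Suc)
  qed
  show ?case
  proof (cases "won_within G first k p \<or> set p = pverts G")
    case True
    then show ?thesis
      using win less.prems by (auto simp: complete_play_def partial_play_def)
  next
    case False
    then have nw: "\<not> won_within G first k p" and ne: "pverts G - set p \<noteq> {}"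
      using less.prems by (auto simp: partial_play_def)
    show ?thesis
    proof (cases "to_move first (length p)")
      case Dominator
      let ?v = "\<sigma> p"
      have v: "?v \<in> pverts G - set p"
        using strat less.prems False Dominator by (auto simp: dominator_strategy_def)
      \<comment> \<open>If this very move completes the win, the position after it is dominated and
        the unspent part of \<open>k\<close> serves as \<open>l\<close>.\<close>
      then have "\<exists>l. l + card (claimed first Dominator (p @ [?v])) = k \<and>
        dwin G Staller (claimed first Dominator (p @ [?v])) (pverts G - set p - {?v}) l"
        using IH[OF v] nw Dominator le_add_diff_inverse2 dwin.dominated
        unfolding won_within_snoc by (metis opponent.simps(1))
      then obtain l where l: "Suc l + card (claimed first Dominator p) = k"
        and "dwin G Staller (insert ?v (claimed first Dominator p)) (pverts G - set p - {?v}) l"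
        using v Dominator card_claimed_snoc[of ?v p first Dominator] by (auto simp: claimed_snoc)
      from v this(2) have "dwin G Dominator (claimed first Dominator p) (pverts G - set p) (Suc l)"
        by (rule dwin.dominator_moves)
      then show ?thesis using l Dominator by auto
    next
      case Staller
      have *: "\<exists>l. l + card (claimed first Dominator p) = k \<and>
        dwin G Dominator (claimed first Dominator p) (pverts G - set p - {v}) l"
        if v: "v \<in> pverts G - set p" for v
      proof -
        \<comment> \<open>Staller's move leaves Dominator's set unchanged, so no win can first
          appear with it.\<close>
        have "\<not> won_within G first k (p @ [v])"
          using nw v Staller won_within_now[of G first p k]
          by (auto simp: won_within_snoc claimed_snoc)
        then show ?thesis
          using IH[OF v] v Staller by (simp add: claimed_snoc)
      qed
      then have "card (claimed first Dominator p) \<le> k" using ne by fastforce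
      \<comment> \<open>\<open>staller_moves\<close> asks for one budget common to all
        \<open>v\<close>; the equation with \<open>k\<close> determines \<open>l\<close>, so the
        budgets found for the single \<open>v\<close> agree.\<close>
      moreover have "dwin G Dominator (claimed first Dominator p) (pverts G - set p - {v})
          (k - card (claimed first Dominator p))" if "v \<in> pverts G - set p" for v
        using *[OF that] by auto
      ultimately show ?thesis
        using ne Staller
        by (auto intro!: exI[of _ "k - card (claimed first Dominator p)"] dwin.staller_moves)
    qed
  qed
qed

text \<open>
  One move serves every budget \<open>k\<close> at once, so a strategy need not keep track of its budget.
\<close>

lemma ex_optimal_move:
  assumes "F \<noteq> {}"
  shows "\<exists>v\<in>F. \<forall>k. dwin G Dominator A F k \<and> \<not> dominating_set G A \<longrightarrow>
    (\<exists>l. k = Suc l \<and> dwin G Staller (insert v A) (F - {v}) l)"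
proof (cases "\<exists>k. dwin G Dominator A F k \<and> \<not> dominating_set G A")
  case True
  \<comment> \<open>A move that works for the least budget leaves a remainder that
    \<open>dwin_mono\<close> enlarges for every other budget.\<close>
  define m where "m = (LEAST k. dwin G Dominator A F k)"
  have "dwin G Dominator A F m"
    unfolding m_def using True by (auto intro: LeastI)
  then obtain v l where v: "v \<in> F" "m = Suc l" "dwin G Staller (insert v A) (F - {v}) l"
    using True by cases auto
  have "\<exists>l. k = Suc l \<and> dwin G Staller (insert v A) (F - {v}) l"
    if "dwin G Dominator A F k" for k
  proof -
    have "m \<le> k" unfolding m_def using that by (rule Least_le)
    with v show ?thesis by (cases k) (auto intro: dwin_mono)
  qed
  with v show ?thesis by blast
qed (use assms in auto)

text \<open>\<open>\<sigma>\<close> picks a vertex from \<open>ex_optimal_move\<close> at every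
  history, and the remaining budget shrinks by one with each of Dominator's moves until he has won.
  Such a vertex exists even after the win, so \<open>\<sigma>\<close> stays legal until the board is
  full.\<close>

lemma dwin_imp_strategy:
  assumes "dwin G first {} (pverts G) k"
  obtains \<sigma> where "dominator_strategy G first \<sigma>"
    and "\<And>p. complete_play G p \<Longrightarrow> follows first \<sigma> p \<Longrightarrow> won_within G first k p"
proof -
  define good where "good p v \<longleftrightarrow> v \<in> pverts G - set p \<and>
    (\<forall>k. dwin G Dominator (claimed first Dominator p) (pverts G - set p) k \<and>
        \<not> dominating_set G (claimed first Dominator p) \<longrightarrow>
      (\<exists>l. k = Suc l \<and>
        dwin G Staller (insert v (claimed first Dominator p)) (pverts G - set p - {v}) l))" for p v
  define \<sigma> where "\<sigma> p = (SOME v. good p v)" for p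
  have good: "good p (\<sigma> p)" if "pverts G - set p \<noteq> {}" for p
    unfolding \<sigma>_def
    using ex_optimal_move[OF that, of G "claimed first Dominator p"]
    by (intro someI_ex[of "good p"]) (unfold good_def, blast)
  have invariant: "won_within G first k p \<or>
    (\<exists>l. l + card (claimed first Dominator p) = k \<and>
      dwin G (to_move first (length p)) (claimed first Dominator p) (pverts G - set p) l)"
    if "partial_play G p" "follows first \<sigma> p" for p
    using that
  proof (induction p rule: rev_induct)
    case Nil
    then show ?case using assms by (simp add: to_move_def)
  next
    case (snoc v p)
    have v: "v \<in> pverts G - set p" "partial_play G p" "follows first \<sigma> p"
      using snoc.prems by (auto simp: partial_play_def follows_snoc)
    have eq: "pverts G - set (p @ [v]) = pverts G - set p - {v}" by auto
    show ?case
    proof (cases "won_within G first k p")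
      case True
      then show ?thesis by (simp add: won_within_snoc)
    next
      case False
      then obtain l where l: "l + card (claimed first Dominator p) = k"
        and dw: "dwin G (to_move first (length p)) (claimed first Dominator p) (pverts G - set p) l"
        using snoc.IH v by blast
      have undom: "\<not> dominating_set G (claimed first Dominator p)"
        using False l won_within_now by fastforce
      show ?thesis
      proof (cases "to_move first (length p)")
        case Dominator
        then have "v = \<sigma> p" using snoc.prems by (simp add: follows_snoc)
        then have "good p v" using good v by blast
        then obtain l' where "l = Suc l'"
          "dwin G Staller (insert v (claimed first Dominator p)) (pverts G - set p - {v}) l'"
          using dw undom Dominator unfolding good_def by auto
        then show ?thesis
          using l v Dominator card_claimed_snoc[of v p first Dominator]
          unfolding eq by (auto simp: claimed_snoc to_move_Suc)
      next
        case Staller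
        from dw[unfolded Staller]
        have "dwin G Dominator (claimed first Dominator p) (pverts G - set p - {v}) l"
          by cases (use undom v in auto)
        then show ?thesis
          using l Staller unfolding eq by (auto simp: claimed_snoc to_move_Suc)
      qed
    qed
  qed
  show thesis
  proof (rule that)
    show "dominator_strategy G first \<sigma>"
      unfolding dominator_strategy_def
    proof (intro allI impI)
      fix p
      assume "partial_play G p \<and> follows first \<sigma> p \<and> set p \<noteq> pverts G \<and>
        to_move first (length p) = Dominator"
      then have "pverts G - set p \<noteq> {}" by (auto simp: partial_play_def)
      from good[OF this] show "\<sigma> p \<in> pverts G - set p" by (simp add: good_def)
    qed
  next
    fix p
    assume p: "complete_play G p" "follows first \<sigma> p"
    have "won_within G first k p"
      if l: "l + card (claimed first Dominator p) = k"
        and dw: "dwin G (to_move first (length p)) (claimed first Dominator p) {} l" for l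
      using dw
    proof cases
      case dominated
      then show ?thesis using l by (intro won_within_now) auto
    qed auto
    then show "won_within G first k p"
      using invariant[of p] p by (auto simp: complete_play_def partial_play_def)
  qed
qed

section \<open>Values of the game and the bounds for the product\<close>

lemma dominator_wins_within_iff_dwin:
  assumes "finite (pverts G)"
  shows "dominator_wins_within G first k \<longleftrightarrow> dwin G first {} (pverts G) k"
proof
  assume "dominator_wins_within G first k"
  then obtain \<sigma> where \<sigma>: "dominator_strategy G first \<sigma>"
    "\<And>p. complete_play G p \<Longrightarrow> follows first \<sigma> p \<Longrightarrow> won_within G first k p"
    by (auto simp: dominator_wins_within_def moves_to_win_le_iff)
  have "partial_play G []" "follows first \<sigma> []"
    by (auto simp: partial_play_def follows_def)
  \<comment> \<open>For the empty play no move has been spent, so \<open>l\<close> is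
    \<open>k\<close>; a win already there means that the empty set dominates.\<close>
  from strategy_imp_dwin[OF assms \<sigma> this] show "dwin G first {} (pverts G) k"
    by (auto simp: won_within_def to_move_def intro: dwin.dominated)
next
  assume "dwin G first {} (pverts G) k"
  then show "dominator_wins_within G first k"
    by (rule dwin_imp_strategy) (auto simp: dominator_wins_within_def moves_to_win_le_iff)
qed

text \<open>An infimum of extended naturals that is at most a finite \<open>k\<close> is attained,
  so a single strategy realises the bound.\<close>

lemma mb_number_le_iff: "mb_number G first \<le> enat k \<longleftrightarrow> dominator_wins_within G first k"
proof -
  have less: "x \<le> enat k \<longleftrightarrow> x < enat (Suc k)" for x
    by (cases x) auto
  show ?thesis
    unfolding less mb_number_def INF_less_iff
    by (simp add: less[symmetric] SUP_le_iff dominator_wins_within_def)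
qed

theorem theorem3:
  fixes G :: "'a pair_pre_digraph" and n :: nat
  assumes "pair_graph G" and "card (pverts G) = n"
  shows "(\<forall>first. dominator_wins_within (G \<box> K2) first n) \<and>
    (dominator_wins G Dominator \<and> dominator_wins G Staller \<longrightarrow>
      gamma_MB (G \<box> K2) \<le> min (gamma_MB G + gamma_MB' G) (enat n) \<and>
      gamma_MB' (G \<box> K2) \<le> min (2 * gamma_MB' G) (enat n))"
proof -
  interpret pair_graph G by fact
  have fin2: "finite (pverts (G \<box> K2))" by (simp add: pverts_prod_K2)
  have mb_iff: "mb_number G first \<le> enat k \<longleftrightarrow> dwin G first {} (pverts G) k" for first k
    by (simp add: mb_number_le_iff dominator_wins_within_iff_dwin)
  have mb2_iff: "mb_number (G \<box> K2) first \<le> enat k \<longleftrightarrow>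
      dwin (G \<box> K2) first {} (pverts (G \<box> K2)) k" for first k
    by (simp add: mb_number_le_iff dominator_wins_within_iff_dwin fin2)
  \<comment> \<open>At the start all \<open>n\<close> pairs are without a vertex of
    Dominator.\<close>
  have "dwin (G \<box> K2) Staller {} (pverts (G \<box> K2)) n"
    by (rule dwin_pairing) (use assms(2) in \<open>auto simp: pverts_prod_K2\<close>)
  then have "dwin (G \<box> K2) first {} (pverts (G \<box> K2)) n" for first
    by (cases first) (auto intro: dwin_skip)
  then have within: "dominator_wins_within (G \<box> K2) first n" for first
    by (simp add: dominator_wins_within_iff_dwin fin2)
  \<comment> \<open>One copy carries the game begun by \<open>first\<close>, the other the S-game;
    the two values of \<open>first\<close> give the two sums. An infinite summand makes the bound
    trivial.\<close>
  have sum: "mb_number (G \<box> K2) first \<le> mb_number G first + mb_number G Staller" for first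
  proof (cases "mb_number G first"; cases "mb_number G Staller")
    fix k l assume kl: "mb_number G first = enat k" "mb_number G Staller = enat l"
    then have "dwin G first {} (pverts G) k" "dwin G Staller {} (pverts G) l"
      by (simp_all flip: mb_iff)
    moreover have "slice b ({} :: ('a \<times> bool) set) = {}"
      and "slice b (pverts (G \<box> K2)) = pverts G" for b
      by (auto simp: slice_def pverts_prod_K2)
    ultimately have "dwin (G \<box> K2) first {} (pverts (G \<box> K2)) (k + l)"
      using dwin_prod_K2[OF fin2, of G first True "{}" k l] by simp
    then show ?thesis by (simp add: kl mb2_iff)
  qed auto
  show ?thesis
    using within sum[of Dominator] sum[of Staller]
    by (simp add: gamma_MB_def gamma_MB'_def mb_number_le_iff mult_2)
qed

end
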